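(* Let $X$ be an Archimedean partially ordered vector space with order unit $u$. Let $M_1,M_2\subseteq\overline{\Lambda}$ be saturated sets and let $B_1=Z(M_1)$ and $B_2=Z(M_2)$. Then $\{M_1,M_2\}$ is a bisaturated pair in $\overline{\Lambda}$ if and only if $B_1={B_2}^d$ and $B_2={B_1}^d$.
   Context: Let $X$ be a real vector space partially ordered by a cone $K$ (so $K$ is closed under addition and multiplication by nonnegative scalars, $K\cap(-K)=\{0\}$, and $x\le y$ iff $y-x\in K$). $X$ is Archimedean if $nx\le y$ for all $n\in\mathbb{N}$ implies $x\le 0$. An element $u\in K$ is an order unit if for each $x\in X$ there is $\alpha\ge 0$ with $-\alpha u\le x\le\alpha u$. Put $\|x\|_u=\inf\{\alpha>0\colon -\alpha u\le x\le \alpha u\}$, let $X'$ be the norm dual of $(X,\|\cdot\|_u)$ with its weak* topology, $K'=\{\varphi\in X'\colon \varphi(K)\subseteq[0,\infty)\}$, $\Sigma=\{\varphi\in K'\colon\varphi(u)=1\}$, $\Lambda$ the set of extreme points of $\Sigma$, and $\overline{\Lambda}$ the weak* closure of $\Lambda$ in $X'$. For $M\subseteq X$, $M^u$ is the set of upper bounds of $M$ in $X$. Elements $x,y\in X$ are disjoint, $x\perp y$, if $\{x+y,-x-y\}^u=\{x-y,-x+y\}^u$. The disjoint complement of $M\subseteq X$ is $M^d=\{y\in X\colon x\perp y\text{ for all }x\in M\}$. For $M\subseteq\overline{\Lambda}$: $Z(M)=\{x\in X\colon\varphi(x)=0\text{ for all }\varphi\in M\}$. With $\mathrm{aff}$ the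 affine hull ($\mathrm{aff}(\emptyset)=\emptyset$) and weak* closures, $M$ is saturated if $M=\overline{\Lambda}\cap\overline{\mathrm{aff}(M)}$ (equivalently, $M=\overline{\Lambda}\cap\overline{\mathrm{span}(M)}$). $\{M_1,M_2\}$ is a bisaturated pair in $\overline{\Lambda}$ if $M_1=\overline{\Lambda}\cap\overline{\mathrm{aff}(\overline{\Lambda}\setminus M_2)}$ and $M_2=\overline{\Lambda}\cap\overline{\mathrm{aff}(\overline{\Lambda}\setminus M_1)}$. *)

theory Defs
  imports "HOL-Analysis.Analysis" "HOL-Library.Function_Algebras"
begin

(* Functionals are plain functions 'a => real, made into a real vector space
   pointwise, so that extreme_point_of and affine hull apply to them. *)

instantiation "fun" :: (type, real_vector) real_vector
begin

definition scaleR_fun :: "real \<Rightarrow> ('a \<Rightarrow> 'b) \<Rightarrow> 'a \<Rightarrow> 'b" where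
  "scaleR_fun c f = (\<lambda>x. c *\<^sub>R f x)"

instance
  by standard (simp_all add: scaleR_fun_def fun_eq_iff algebra_simps)

end

lemma scaleR_fun_apply [simp]: "(c *\<^sub>R f) x = c *\<^sub>R f x"
  by (simp add: scaleR_fun_def)

(* A vector space partially ordered by a cone K is a type of class
   ordered_real_vector; K is {x. 0 <= x}. *)

definition order_unit :: "'a::ordered_real_vector \<Rightarrow> bool" where
  "order_unit u \<longleftrightarrow> 0 \<le> u \<and> (\<forall>x. \<exists>\<alpha>\<ge>0. - (\<alpha> *\<^sub>R u) \<le> x \<and> x \<le> \<alpha> *\<^sub>R u)"

definition unit_norm :: "'a::ordered_real_vector \<Rightarrow> 'a \<Rightarrow> real" where
  "unit_norm u x = Inf {\<alpha>. 0 < \<alpha> \<and> - (\<alpha> *\<^sub>R u) \<le> x \<and> x \<le> \<alpha> *\<^sub>R u}"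

definition norm_dual :: "'a::ordered_real_vector \<Rightarrow> ('a \<Rightarrow> real) set" where
  "norm_dual u = {\<phi>. linear \<phi> \<and> (\<exists>C. \<forall>x. \<bar>\<phi> x\<bar> \<le> C * unit_norm u x)}"

(* powertop_real UNIV is the topology of pointwise convergence on 'a => real. *)

definition weak_star :: "'a::ordered_real_vector \<Rightarrow> ('a \<Rightarrow> real) topology" where
  "weak_star u = subtopology (powertop_real UNIV) (norm_dual u)"

lemma limitin_weak_star:
  "limitin (weak_star u) f \<phi> F \<longleftrightarrow>
     \<phi> \<in> norm_dual u \<and> (\<forall>\<^sub>F i in F. f i \<in> norm_dual u) \<and>
     (\<forall>x. ((\<lambda>i. f i x) \<longlongrightarrow> \<phi> x) F)"
  by (auto simp: weak_star_def limitin_subtopology limitin_componentwise)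

definition dual_cone :: "'a::ordered_real_vector \<Rightarrow> ('a \<Rightarrow> real) set" where
  "dual_cone u = {\<phi> \<in> norm_dual u. \<forall>x\<ge>0. 0 \<le> \<phi> x}"

definition states :: "'a::ordered_real_vector \<Rightarrow> ('a \<Rightarrow> real) set" where
  "states u = {\<phi> \<in> dual_cone u. \<phi> u = 1}"

definition pure_states :: "'a::ordered_real_vector \<Rightarrow> ('a \<Rightarrow> real) set" where
  "pure_states u = {\<phi>. \<phi> extreme_point_of states u}"

definition closed_pure_states :: "'a::ordered_real_vector \<Rightarrow> ('a \<Rightarrow> real) set" where
  "closed_pure_states u = weak_star u closure_of pure_states u"

definition upper_bounds :: "'a::ordered_real_vector set \<Rightarrow> 'a set" where
  "upper_bounds M = {z. \<forall>x\<in>M. x \<le> z}"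

definition disjoint_elements :: "'a::ordered_real_vector \<Rightarrow> 'a \<Rightarrow> bool" where
  "disjoint_elements x y \<longleftrightarrow>
     upper_bounds {x + y, - x - y} = upper_bounds {x - y, - x + y}"

definition disjoint_complement :: "'a::ordered_real_vector set \<Rightarrow> 'a set" where
  "disjoint_complement M = {y. \<forall>x\<in>M. disjoint_elements x y}"

definition zero_set :: "('a \<Rightarrow> real) set \<Rightarrow> 'a set" where
  "zero_set M = {x. \<forall>\<phi>\<in>M. \<phi> x = 0}"

definition saturated :: "'a::ordered_real_vector \<Rightarrow> ('a \<Rightarrow> real) set \<Rightarrow> bool" where
  "saturated u M \<longleftrightarrow>
     M = closed_pure_states u \<inter> (weak_star u closure_of (affine hull M))"

definition bisaturated_pair ::
  "'a::ordered_real_vector \<Rightarrow> ('a \<Rightarrow> real) set \<Rightarrow> ('a \<Rightarrow> real) set \<Rightarrow> bool" where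
  "bisaturated_pair u M\<^sub>1 M\<^sub>2 \<longleftrightarrow>
     M\<^sub>1 = closed_pure_states u \<inter>
       (weak_star u closure_of (affine hull (closed_pure_states u - M\<^sub>2))) \<and>
     M\<^sub>2 = closed_pure_states u \<inter>
       (weak_star u closure_of (affine hull (closed_pure_states u - M\<^sub>1)))"

end

theory Submission
  imports Defs
begin

text \<open>
  Two elements are disjoint iff every pure state, hence every weak* limit of pure states, vanishes
  at one of them. One direction holds because the pure states determine the order. The other one
  holds because a pure state \<open>\<phi>\<close> dominates only its own multiples, so that by Hahn-Banach
  the infimum of \<open>\<phi> z\<close> over the common upper bounds \<open>z\<close> of \<open>a\<close> and \<open>b\<close> is
  \<open>max (\<phi> a) (\<phi> b)\<close>. Moreover, a set \<open>N\<close> of limits of pure states has as its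
  saturated hull all such limits that vanish on \<open>zero_set N\<close>. Hence the disjoint complement
  of \<open>zero_set M\<close> is the zero set of the complement of \<open>M\<close> whenever \<open>M\<close> is saturated,
  and zero sets agree iff the saturated hulls do.
\<close>

section \<open>Sublinear functionals and cones in the product with the reals\<close>

definition sublinear :: "('a::real_vector \<Rightarrow> real) \<Rightarrow> bool" where
  "sublinear p \<longleftrightarrow> (\<forall>x y. p (x + y) \<le> p x + p y) \<and> (\<forall>c\<ge>0. \<forall>x. p (c *\<^sub>R x) = c * p x)"

lemma sublinear_add: "sublinear p \<Longrightarrow> p (x + y) \<le> p x + p y"
  by (simp add: sublinear_def)

lemma sublinear_scaleR: "sublinear p \<Longrightarrow> 0 \<le> c \<Longrightarrow> p (c *\<^sub>R x) = c * p x"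
  by (simp add: sublinear_def)

lemma sublinear_zero: "sublinear p \<Longrightarrow> p 0 = 0"
  using sublinear_scaleR[of p 0 0] by simp

lemma sublinear_minus: "sublinear p \<Longrightarrow> - p (- x) \<le> p x"
  using sublinear_add[of p x "- x"] sublinear_zero[of p] by simp

text \<open>Oddness turns subadditivity at \<open>- x\<close> and \<open>- y\<close> into
  superadditivity at \<open>x\<close> and \<open>y\<close>, and extends positive homogeneity to
  negative scalars.\<close>

lemma sublinear_odd_linear:
  assumes q: "sublinear q" and odd: "\<And>x. q (- x) = - q x"
  shows "linear q"
proof (rule linearI)
  fix x y
  have "q (- x + - y) \<le> q (- x) + q (- y)"
    by (rule sublinear_add[OF q])
  then have "q x + q y \<le> q (x + y)"
    using odd[of "x + y"] by (simp add: odd)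
  with sublinear_add[OF q, of x y] show "q (x + y) = q x + q y"
    by simp
next
  fix c x
  show "q (c *\<^sub>R x) = c *\<^sub>R q x"
  proof (cases "c \<ge> 0")
    case True
    then show ?thesis using sublinear_scaleR[OF q] by simp
  next
    case False
    then have "q ((- c) *\<^sub>R x) = (- c) * q x"
      by (intro sublinear_scaleR[OF q]) simp
    then show ?thesis using odd[of "c *\<^sub>R x"] by simp
  qed
qed

text \<open>Every sublinear functional below is the lower boundary of a convex cone \<open>R\<close> in
  \<open>'a \<times> real\<close>.\<close>

locale epigraph_cone =
  fixes R :: "'a::real_vector \<Rightarrow> real \<Rightarrow> bool"
  assumes add: "R x s \<Longrightarrow> R y t \<Longrightarrow> R (x + y) (s + t)"
    and scale: "0 < c \<Longrightarrow> R x t \<Longrightarrow> R (c *\<^sub>R x) (c * t)"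
    and zero: "R 0 0"
    and nonneg: "R 0 t \<Longrightarrow> 0 \<le> t"
    and total: "\<exists>t. R x t"
begin

definition lower :: "'a \<Rightarrow> real" where
  "lower x = Inf {t. R x t}"

text \<open>Adding a fixed \<open>R (- x) s\<close> to \<open>R x t\<close> gives
  \<open>R 0 (t + s)\<close>, so \<open>- s\<close> is a lower bound. Together with
  \<open>total\<close> this makes the infimum in \<open>lower\<close> meaningful.\<close>

lemma bdd: "bdd_below {t. R x t}"
proof -
  obtain s where s: "R (- x) s" using total by blast
  have "- s \<le> t" if "R x t" for t
    using nonneg[of "t + s"] add[OF that s] by simp
  then show ?thesis by (intro bdd_belowI[of _ "- s"]) auto
qed

lemma lower_le: "R x t \<Longrightarrow> lower x \<le> t"
  unfolding lower_def by (intro cInf_lower bdd) simp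

lemma lower_ge: "(\<And>t. R x t \<Longrightarrow> b \<le> t) \<Longrightarrow> b \<le> lower x"
  unfolding lower_def using total by (intro cInf_greatest) auto

lemma lower_less: "lower x < b \<Longrightarrow> \<exists>t<b. R x t"
  by (metis not_le lower_ge)

lemma lower_scaleR_le: "0 < c \<Longrightarrow> lower (c *\<^sub>R x) \<le> c * lower x"
proof -
  assume c: "0 < c"
  have "lower (c *\<^sub>R x) / c \<le> lower x"
  proof (rule lower_ge)
    fix t assume "R x t"
    from lower_le[OF scale[OF c this]] show "lower (c *\<^sub>R x) / c \<le> t"
      using c by (simp add: divide_le_eq mult.commute)
  qed
  then show ?thesis using c by (simp add: divide_le_eq mult.commute)
qed

lemma sublinear_lower: "sublinear lower"
  unfolding sublinear_def
proof (intro conjI allI impI)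
  fix x y
  \<comment> \<open>The infimum is taken over one summand at a time: first over \<open>s\<close>
    with \<open>t\<close> fixed, then over \<open>t\<close>.\<close>
  have "lower (x + y) - t \<le> lower x" if t: "R y t" for t
  proof (rule lower_ge)
    fix s assume "R x s"
    from lower_le[OF add[OF this t]] show "lower (x + y) - t \<le> s" by simp
  qed
  then have "lower (x + y) - lower x \<le> lower y"
    by (intro lower_ge) (simp add: algebra_simps)
  then show "lower (x + y) \<le> lower x + lower y" by simp
next
  fix c :: real and x :: 'a
  assume c: "0 \<le> c"
  show "lower (c *\<^sub>R x) = c * lower x"
  proof (cases "c = 0")
    case True
    have "lower 0 = 0"
      using lower_le[OF zero] lower_ge[of 0 0] nonneg by force
    then show ?thesis using True by simp
  next
    case False
    then have c: "0 < c" using c by simp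
    \<comment> \<open>The reverse inequality is the one already known, applied to
      \<open>inverse c\<close> at the point \<open>c *\<^sub>R x\<close>.\<close>
    have "lower x \<le> inverse c * lower (c *\<^sub>R x)"
      using lower_scaleR_le[of "inverse c" "c *\<^sub>R x"] c by simp
    then have "c * lower x \<le> lower (c *\<^sub>R x)"
      using c by (simp add: field_simps)
    with lower_scaleR_le[OF c] show ?thesis by (meson antisym)
  qed
qed

end

section \<open>An extremal Hahn-Banach theorem\<close>

text \<open>The linear functionals below \<open>p\<close> that attain the value \<open>p a\<close> at \<open>a\<close> are exactly
  those below \<open>q\<close>.\<close>

lemma sublinear_tangent:
  assumes p: "sublinear p"
  obtains q where "sublinear q" "\<And>x. q x \<le> p x" "q (- a) \<le> - p a"
    "\<And>f. linear f \<Longrightarrow> (\<And>x. f x \<le> p x) \<Longrightarrow> f a = p a \<Longrightarrow> (\<And>x. f x \<le> q x)"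
proof -
  \<comment> \<open>A linear \<open>f\<close> below \<open>p\<close> with \<open>f a = p a\<close>
    satisfies \<open>f x = f (x + t *\<^sub>R a) - t * p a\<close>, which is at most
    \<open>p (x + t *\<^sub>R a) - t * p a\<close>. The infimum of these bounds over
    \<open>t \<ge> 0\<close> is the desired \<open>q\<close>.\<close>
  define R where "R x r \<longleftrightarrow> (\<exists>t\<ge>0. p (x + t *\<^sub>R a) - t * p a \<le> r)" for x r
  interpret epigraph_cone R
  proof
    fix x y r s
    assume "R x r" "R y s"
    then obtain t t' where t: "0 \<le> t" "p (x + t *\<^sub>R a) - t * p a \<le> r"
      "0 \<le> t'" "p (y + t' *\<^sub>R a) - t' * p a \<le> s"
      unfolding R_def by blast
    have "p ((x + t *\<^sub>R a) + (y + t' *\<^sub>R a)) \<le> p (x + t *\<^sub>R a) + p (y + t' *\<^sub>R a)"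
      by (rule sublinear_add[OF p])
    moreover have "(x + t *\<^sub>R a) + (y + t' *\<^sub>R a) = (x + y) + (t + t') *\<^sub>R a"
      by (simp add: algebra_simps)
    ultimately show "R (x + y) (r + s)"
      unfolding R_def using t by (intro exI[of _ "t + t'"]) (simp add: algebra_simps)
  next
    fix c x r
    assume c: "(0::real) < c" and "R x r"
    then obtain t where t: "0 \<le> t" "p (x + t *\<^sub>R a) - t * p a \<le> r"
      unfolding R_def by blast
    have "p (c *\<^sub>R x + (c * t) *\<^sub>R a) = c * p (x + t *\<^sub>R a)"
      using sublinear_scaleR[OF p, of c "x + t *\<^sub>R a"] c by (simp add: algebra_simps)
    moreover have "c * (p (x + t *\<^sub>R a) - t * p a) \<le> c * r"
      using t c by simp
    ultimately show "R (c *\<^sub>R x) (c * r)"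
      unfolding R_def using t c by (intro exI[of _ "c * t"]) (simp add: algebra_simps)
  next
    show "R 0 0"
      unfolding R_def by (intro exI[of _ 0]) (simp add: sublinear_zero[OF p])
  next
    fix r assume "R 0 r"
    then show "0 \<le> r"
      unfolding R_def by (auto simp: sublinear_scaleR[OF p])
  next
    fix x
    show "\<exists>r. R x r"
      unfolding R_def by (intro exI[of _ "p x"] exI[of _ 0]) simp
  qed
  show thesis
  proof (rule that[of lower])
    show "sublinear lower" by (rule sublinear_lower)
    \<comment> \<open>The parameter \<open>t = 0\<close> gives the bound \<open>p x\<close>; at
      \<open>- a\<close>, the parameter \<open>t = 1\<close> gives \<open>p 0 - p a\<close>.\<close>
    show "lower x \<le> p x" for x
      by (rule lower_le) (auto simp: R_def intro!: exI[of _ 0])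
    show "lower (- a) \<le> - p a"
      by (rule lower_le) (auto simp: R_def sublinear_zero[OF p] intro!: exI[of _ 1])
    show "f x \<le> lower x" if f: "linear f" "\<And>x. f x \<le> p x" "f a = p a" for f x
    proof (rule lower_ge)
      fix r assume "R x r"
      then obtain t where "0 \<le> t" "p (x + t *\<^sub>R a) - t * p a \<le> r"
        unfolding R_def by blast
      then show "f x \<le> r"
        using f(2)[of "x + t *\<^sub>R a"] by (simp add: linear_add[OF f(1)] linear_scale[OF f(1)] f(3))
    qed
  qed
qed

text \<open>This supplies the lower bounds for Zorn's lemma. The union of the epigraphs of a chain
  is closed under addition because the smaller of two members serves both summands.\<close>

lemma sublinear_chain_Inf:
  assumes p: "sublinear p" and "C \<noteq> {}"
    and C: "\<And>q. q \<in> C \<Longrightarrow> sublinear q" "\<And>q x. q \<in> C \<Longrightarrow> q x \<le> p x"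
    and chain: "\<And>q q'. q \<in> C \<Longrightarrow> q' \<in> C \<Longrightarrow> q \<le> q' \<or> q' \<le> q"
  obtains m where "sublinear m" "\<And>q x. q \<in> C \<Longrightarrow> m x \<le> q x"
    "\<And>x b. (\<And>q. q \<in> C \<Longrightarrow> b \<le> q x) \<Longrightarrow> b \<le> m x"
proof -
  define R where "R x r \<longleftrightarrow> (\<exists>q\<in>C. q x \<le> r)" for x r
  interpret epigraph_cone R
  proof
    fix x y r s
    assume "R x r" "R y s"
    then obtain q q' where q: "q \<in> C" "q x \<le> r" "q' \<in> C" "q' y \<le> s"
      unfolding R_def by blast
    obtain q'' where q'': "q'' \<in> C" "q'' x \<le> q x" "q'' y \<le> q' y"
      using chain[OF q(1,3)] q(1,3) by (auto simp: le_fun_def)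
    have "q'' (x + y) \<le> r + s"
      using sublinear_add[OF C(1)[OF q''(1)], of x y] q q'' by linarith
    then show "R (x + y) (r + s)"
      unfolding R_def using q'' by blast
  next
    fix c x r
    assume "(0::real) < c" "R x r"
    then show "R (c *\<^sub>R x) (c * r)"
      unfolding R_def by (auto simp: sublinear_scaleR C(1))
  next
    show "R 0 0"
      unfolding R_def using \<open>C \<noteq> {}\<close> C(1) by (force simp: sublinear_zero)
  next
    fix r assume "R 0 r"
    then show "0 \<le> r"
      unfolding R_def using C(1) by (auto simp: sublinear_zero)
  next
    fix x
    show "\<exists>r. R x r"
      unfolding R_def using \<open>C \<noteq> {}\<close> by blast
  qed
  show thesis
  proof (rule that[of lower])
    show "sublinear lower" by (rule sublinear_lower)
    show "lower x \<le> q x" if "q \<in> C" for q x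
      using that by (intro lower_le) (auto simp: R_def)
    show "b \<le> lower x" if "\<And>q. q \<in> C \<Longrightarrow> b \<le> q x" for x b
      using that by (intro lower_ge) (force simp: R_def)
  qed
qed

text \<open>The functionals below \<open>q\<close> form a face of the set of those below \<open>p\<close>.\<close>

definition face_below :: "('a::real_vector \<Rightarrow> real) \<Rightarrow> ('a \<Rightarrow> real) \<Rightarrow> bool" where
  "face_below p q \<longleftrightarrow>
     (\<forall>f g t. linear f \<longrightarrow> linear g \<longrightarrow> (\<forall>x. f x \<le> p x) \<longrightarrow> (\<forall>x. g x \<le> p x) \<longrightarrow> 0 < t \<longrightarrow> t < 1 \<longrightarrow>
        (\<forall>x. (1 - t) * f x + t * g x \<le> q x) \<longrightarrow> (\<forall>x. f x \<le> q x) \<and> (\<forall>x. g x \<le> q x))"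

lemma face_belowD:
  assumes "face_below p q" "linear f" "linear g" "\<And>x. f x \<le> p x" "\<And>x. g x \<le> p x"
    "0 < t" "t < 1" "\<And>x. (1 - t) * f x + t * g x \<le> q x"
  shows "f x \<le> q x" "g x \<le> q x"
  using assms unfolding face_below_def by blast+

lemma face_below_self: "face_below p p"
  by (simp add: face_below_def)

text \<open>A face of a face is a face: the linear functionals below \<open>r\<close> are those
  below \<open>q\<close> with the maximal value \<open>q a\<close> at \<open>a\<close>, and a proper
  convex combination attains a maximum only if both of its terms do.\<close>

lemma face_below_tangent:
  assumes face: "face_below p q" and q: "sublinear q"
  obtains r where "sublinear r" "\<And>x. r x \<le> q x" "r (- a) \<le> - q a" "face_below p r"
proof -
  obtain r where r: "sublinear r" "\<And>x. r x \<le> q x" "r (- a) \<le> - q a"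
    "\<And>f x. linear f \<Longrightarrow> (\<And>x. f x \<le> q x) \<Longrightarrow> f a = q a \<Longrightarrow> f x \<le> r x"
    using sublinear_tangent[OF q] by blast
  have "face_below p r"
    unfolding face_below_def
  proof (intro allI impI)
    fix f g :: "'a \<Rightarrow> real" and t :: real
    assume A: "linear f" "linear g" "\<forall>x. f x \<le> p x" "\<forall>x. g x \<le> p x" "0 < t" "t < 1"
      "\<forall>x. (1 - t) * f x + t * g x \<le> r x"
    have le_q: "f x \<le> q x" "g x \<le> q x" for x
      using face_belowD[OF face A(1,2) _ _ A(5,6), of x] A(3,4,7) r(2) by (blast intro: order_trans)+
    have "(1 - t) * f (- a) + t * g (- a) \<le> - q a"
      using A(7) r(3) order_trans by blast
    \<comment> \<open>Both weighted gaps are nonnegative and their sum is nonpositive, so both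
      vanish.\<close>
    then have "(1 - t) * (q a - f a) + t * (q a - g a) \<le> 0"
      by (simp add: linear_neg[OF A(1)] linear_neg[OF A(2)] algebra_simps)
    moreover have "0 \<le> (1 - t) * (q a - f a)" "0 \<le> t * (q a - g a)"
      using le_q[of a] A(5,6) by simp_all
    ultimately have "(1 - t) * (q a - f a) = 0" "t * (q a - g a) = 0"
      by linarith+
    then have "f a = q a" "g a = q a"
      using A(5,6) by simp_all
    then show "(\<forall>x. f x \<le> r x) \<and> (\<forall>x. g x \<le> r x)"
      using r(4) A(1,2) le_q by blast
  qed
  with r(1-3) show thesis by (rule that)
qed

text \<open>A minimal \<open>q \<le> p\<close> with \<open>face_below p q\<close> is linear, since otherwise a tangent of \<open>q\<close>
  would be smaller, and then it is an extreme functional below \<open>p\<close>. This replaces both Hahn-Banach and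
  Krein-Milman, with no compactness argument.\<close>

theorem Hahn_Banach_extreme:
  fixes p :: "'a::real_vector \<Rightarrow> real"
  assumes p: "sublinear p"
  obtains f where "linear f" "\<And>x. f x \<le> p x" "f a = p a"
    "\<And>g h t. linear g \<Longrightarrow> linear h \<Longrightarrow> (\<And>x. g x \<le> p x) \<Longrightarrow> (\<And>x. h x \<le> p x) \<Longrightarrow> 0 < t \<Longrightarrow> t < 1 \<Longrightarrow>
       (\<And>x. f x = (1 - t) * g x + t * h x) \<Longrightarrow> g = f \<and> h = f"
proof -
  \<comment> \<open>Starting the descent at the tangent of \<open>p\<close> at \<open>a\<close>
    ensures that every linear functional below \<open>p'\<close> has the value \<open>p a\<close> at
    \<open>a\<close>.\<close>
  obtain p' where p': "sublinear p'" "\<And>x. p' x \<le> p x" "p' (- a) \<le> - p a" "face_below p p'"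
    using face_below_tangent[OF face_below_self p] by blast
  define A where "A = {q. sublinear q \<and> q \<le> p' \<and> face_below p q}"
  \<comment> \<open>The order is reversed, so Zorn's lemma yields a pointwise minimal
    element.\<close>
  have "\<exists>m\<in>A. \<forall>q\<in>A. m \<ge> q \<longrightarrow> q = m"
  proof (rule predicate_Zorn)
    show "partial_order_on A (relation_of (\<ge>) A)"
      by (rule partial_order_on_relation_ofI) auto
    fix C assume "C \<in> Chains (relation_of (\<ge>) A)"
    then have C: "C \<subseteq> A" "\<And>q q'. q \<in> C \<Longrightarrow> q' \<in> C \<Longrightarrow> q \<le> q' \<or> q' \<le> q"
      by (auto simp: Chains_def relation_of_def)
    show "\<exists>m\<in>A. \<forall>q\<in>C. q \<ge> m"
    proof (cases "C = {}")
      case True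
      have "p' \<in> A" using p' by (simp add: A_def)
      with True show ?thesis by blast
    next
      case False
      obtain m where m: "sublinear m" "\<And>q x. q \<in> C \<Longrightarrow> m x \<le> q x"
        "\<And>x b. (\<And>q. q \<in> C \<Longrightarrow> b \<le> q x) \<Longrightarrow> b \<le> m x"
      proof (rule sublinear_chain_Inf[OF p'(1) False])
        show "sublinear q" "q x \<le> p' x" if "q \<in> C" for q x
          using C(1) that by (auto simp: A_def le_fun_def)
      qed (use C(2) in blast)+
      \<comment> \<open>A combination below \<open>m\<close> is below every \<open>q\<close> in the
        chain, so \<open>f\<close> and \<open>g\<close> are below every such \<open>q\<close>, hence
        below the greatest lower bound \<open>m\<close>.\<close>
      have "face_below p m"
        unfolding face_below_def
      proof (intro allI impI)
        fix f g :: "'a \<Rightarrow> real" and t :: real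
        assume F: "linear f" "linear g" "\<forall>x. f x \<le> p x" "\<forall>x. g x \<le> p x" "0 < t" "t < 1"
          "\<forall>x. (1 - t) * f x + t * g x \<le> m x"
        have "f x \<le> q x" "g x \<le> q x" if q: "q \<in> C" for q x
        proof -
          have "face_below p q" using C(1) q by (auto simp: A_def)
          moreover have "(1 - t) * f x + t * g x \<le> q x" for x
            using F(7) m(2)[OF q] order_trans by blast
          ultimately show "f x \<le> q x" "g x \<le> q x"
            using face_belowD[of p q f g t x] F by blast+
        qed
        then show "(\<forall>x. f x \<le> m x) \<and> (\<forall>x. g x \<le> m x)"
          using m(3) by blast
      qed
      moreover obtain q where "q \<in> C" using False by blast
      with m(2) C(1) have "m \<le> p'"
        by (force simp: A_def le_fun_def intro: order_trans)
      ultimately have "m \<in> A" using m(1) by (simp add: A_def)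
      with m(2) show ?thesis by (auto simp: le_fun_def)
    qed
  qed
  then obtain f where f: "sublinear f" "f \<le> p'" "face_below p f"
    and min: "\<And>q. q \<in> A \<Longrightarrow> q \<le> f \<Longrightarrow> q = f"
    by (auto simp: A_def)
  \<comment> \<open>By minimality the tangent of \<open>f\<close> at \<open>b\<close> is
    \<open>f\<close> itself, which gives \<open>f (- b) \<le> - f b\<close>; the reverse inequality
    holds for every sublinear functional.\<close>
  have "f (- b) = - f b" for b
  proof -
    obtain r where r: "sublinear r" "\<And>x. r x \<le> f x" "r (- b) \<le> - f b" "face_below p r"
      using face_below_tangent[OF f(3,1)] by blast
    have "r \<le> f" using r(2) by (simp add: le_fun_def)
    then have "r \<in> A" using r f(2) by (auto simp: A_def)
    then have "r = f" using min \<open>r \<le> f\<close> by blast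
    with r(3) sublinear_minus[OF f(1), of b] show ?thesis by simp
  qed
  then have lin: "linear f" by (rule sublinear_odd_linear[OF f(1)])
  have le_p: "f x \<le> p x" for x
    using f(2) p'(2)[of x] by (auto simp: le_fun_def intro: order_trans)
  show thesis
  proof (rule that[OF lin le_p])
    have "f (- a) \<le> - p a"
      using f(2) p'(3) by (auto simp: le_fun_def intro: order_trans)
    then show "f a = p a"
      using le_p[of a] by (simp add: linear_neg[OF lin])
  next
    fix g h :: "'a \<Rightarrow> real" and t :: real
    assume G: "linear g" "linear h" "\<And>x. g x \<le> p x" "\<And>x. h x \<le> p x" "0 < t" "t < 1"
      "\<And>x. f x = (1 - t) * g x + t * h x"
    \<comment> \<open>The face property puts \<open>g\<close> and \<open>h\<close> below
      \<open>f\<close>; for linear functionals, comparison at both \<open>x\<close> and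
      \<open>- x\<close> then forces equality.\<close>
    have le_f: "g x \<le> f x" "h x \<le> f x" for x
      using face_belowD[OF f(3) G(1-6), of x] G(7) by simp_all
    have eqI: "k = f" if k: "linear k" "\<And>x. k x \<le> f x" for k
    proof
      fix x
      show "k x = f x"
        using k(2)[of x] k(2)[of "- x"] by (simp add: linear_neg[OF k(1)] linear_neg[OF lin])
    qed
    show "g = f \<and> h = f"
      using eqI G(1,2) le_f by blast
  qed
qed

section \<open>Pure states\<close>

lemma linear_mono:
  fixes f :: "'a::ordered_real_vector \<Rightarrow> real"
  assumes "linear f" "\<And>x. 0 \<le> x \<Longrightarrow> 0 \<le> f x" "x \<le> y"
  shows "f x \<le> f y"
  using assms(2)[of "y - x"] assms(3) linear_diff[OF assms(1), of y x] by simp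

text \<open>Positivity and \<open>\<phi> u = 1\<close> force norm continuity with constant 1:
  evaluating \<phi> on an order interval around 0 bounded by multiples of \<open>u\<close> bounds
  its absolute value.\<close>

lemma states_iff:
  assumes unit: "order_unit u"
  shows "\<phi> \<in> states u \<longleftrightarrow> linear \<phi> \<and> (\<forall>x\<ge>0. 0 \<le> \<phi> x) \<and> \<phi> u = 1"
proof
  assume "\<phi> \<in> states u"
  then show "linear \<phi> \<and> (\<forall>x\<ge>0. 0 \<le> \<phi> x) \<and> \<phi> u = 1"
    by (auto simp: states_def dual_cone_def norm_dual_def)
next
  assume \<phi>: "linear \<phi> \<and> (\<forall>x\<ge>0. 0 \<le> \<phi> x) \<and> \<phi> u = 1"
  then have lin: "linear \<phi>" and mono: "\<And>x y. x \<le> y \<Longrightarrow> \<phi> x \<le> \<phi> y"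
    using linear_mono by blast+
  have bound: "\<bar>\<phi> x\<bar> \<le> 1 * unit_norm u x" for x
  proof -
    obtain \<alpha> where \<alpha>: "0 \<le> \<alpha>" "- (\<alpha> *\<^sub>R u) \<le> x" "x \<le> \<alpha> *\<^sub>R u"
      using unit by (auto simp: order_unit_def)
    \<comment> \<open>The infimum in \<open>unit_norm\<close> ranges over positive numbers only,
      while \<alpha> may be 0; \<open>\<alpha> + 1\<close> shows that the set is nonempty.\<close>
    have "\<alpha> *\<^sub>R u \<le> (\<alpha> + 1) *\<^sub>R u"
      using unit by (intro scaleR_right_mono) (auto simp: order_unit_def)
    then have "0 < \<alpha> + 1 \<and> - ((\<alpha> + 1) *\<^sub>R u) \<le> x \<and> x \<le> (\<alpha> + 1) *\<^sub>R u"
      using \<alpha> by (meson add_nonneg_pos le_imp_neg_le order_trans zero_less_one)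
    moreover have "\<bar>\<phi> x\<bar> \<le> \<beta>" if \<beta>: "- (\<beta> *\<^sub>R u) \<le> x" "x \<le> \<beta> *\<^sub>R u" for \<beta>
      using mono[OF \<beta>(1)] mono[OF \<beta>(2)] \<phi>
      by (simp add: linear_neg[OF lin] linear_scale[OF lin] abs_le_iff)
    ultimately show ?thesis
      unfolding unit_norm_def mult_1 by (intro cInf_greatest) auto
  qed
  have "\<phi> \<in> norm_dual u"
    unfolding norm_dual_def by (intro CollectI conjI lin exI[of _ 1] allI bound)
  with \<phi> show "\<phi> \<in> states u"
    by (simp add: states_def dual_cone_def)
qed

lemma pure_states_subset: "pure_states u \<subseteq> states u"
  by (auto simp: pure_states_def extreme_point_of_def)

lemma pure_states_linear: "\<phi> \<in> pure_states u \<Longrightarrow> linear \<phi>"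
  using subsetD[OF pure_states_subset, of \<phi> u] by (simp add: states_def dual_cone_def norm_dual_def)

lemma pure_states_mono: "\<phi> \<in> pure_states u \<Longrightarrow> x \<le> y \<Longrightarrow> \<phi> x \<le> \<phi> y"
  using subsetD[OF pure_states_subset, of \<phi> u]
  by (intro linear_mono[of \<phi>]) (simp_all add: states_def dual_cone_def pure_states_linear)

lemma order_unit_zero:
  fixes u x :: "'a::ordered_real_vector"
  assumes "order_unit u" "u = 0"
  shows "x = 0"
proof (rule antisym)
  obtain \<alpha> where "- (\<alpha> *\<^sub>R u) \<le> x" "x \<le> \<alpha> *\<^sub>R u"
    using assms(1) by (auto simp: order_unit_def)
  then show "x \<le> 0" "0 \<le> x" using assms(2) by simp_all
qed

text \<open>An extreme functional below the gauge \<open>lower w\<close>, the infimum of all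
  \<open>t\<close> with \<open>w \<le> t *\<^sub>R u\<close>, is a pure state. One of them attains
  the gauge at \<open>- x\<close>, so \<open>lower (- x) \<le> 0\<close>, and the Archimedean
  property yields \<open>- x \<le> 0\<close>.\<close>

lemma nonneg_if_pure_states_nonneg:
  fixes u x :: "'a::ordered_real_vector"
  assumes archimedean: "\<forall>x y :: 'a. (\<forall>n::nat. real n *\<^sub>R x \<le> y) \<longrightarrow> x \<le> 0"
    and unit: "order_unit u" and pos: "\<And>\<phi>. \<phi> \<in> pure_states u \<Longrightarrow> 0 \<le> \<phi> x"
  shows "0 \<le> x"
\<comment> \<open>With \<open>u = 0\<close> the space is trivial; otherwise
  \<open>0 \<le> t *\<^sub>R u\<close> forces \<open>0 \<le> t\<close>, which the cone axiom
  \<open>nonneg\<close> demands.\<close>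
proof (cases "u = 0")
  case True
  then show ?thesis using order_unit_zero[OF unit, of x] by simp
next
  case False
  have u: "0 \<le> u" using unit by (simp add: order_unit_def)
  define R where "R w t \<longleftrightarrow> w \<le> t *\<^sub>R u" for w t
  interpret epigraph_cone R
  proof
    fix w t v s assume "R w t" "R v s"
    then show "R (w + v) (t + s)"
      by (simp add: R_def scaleR_add_left add_mono)
  next
    fix c w t assume "(0::real) < c" "R w t"
    then show "R (c *\<^sub>R w) (c * t)"
      unfolding R_def using scaleR_left_mono[of w "t *\<^sub>R u" c] by simp
  next
    show "R 0 0" by (simp add: R_def)
  next
    fix t assume "R 0 t"
    show "0 \<le> t"
    proof (rule ccontr)
      assume t: "\<not> 0 \<le> t"
      have "0 \<le> inverse (- t) *\<^sub>R (t *\<^sub>R u)"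
        by (rule scaleR_nonneg_nonneg) (use t \<open>R 0 t\<close> in \<open>simp_all add: R_def\<close>)
      then have "u \<le> 0" using t by simp
      with u False show False by simp
    qed
  next
    fix w show "\<exists>t. R w t" using unit by (auto simp: R_def order_unit_def)
  qed
  \<comment> \<open>For the converse, positivity comes from the gauge being at most 0 on negative
    elements, and normalization from its bounds 1 at \<open>u\<close> and -1 at
    \<open>- u\<close>.\<close>
  have state_iff: "f \<in> states u \<longleftrightarrow> linear f \<and> (\<forall>w. f w \<le> lower w)" for f
  proof
    assume "f \<in> states u"
    then have f: "linear f" "\<And>w. 0 \<le> w \<Longrightarrow> 0 \<le> f w" "f u = 1"
      by (auto simp: states_iff[OF unit])
    have "f w \<le> lower w" for w
    proof (rule lower_ge)
      fix t assume "R w t"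
      then show "f w \<le> t"
        using linear_mono[OF f(1,2), of w "t *\<^sub>R u"] f(3) by (simp add: R_def linear_scale[OF f(1)])
    qed
    with f show "linear f \<and> (\<forall>w. f w \<le> lower w)" by blast
  next
    assume "linear f \<and> (\<forall>w. f w \<le> lower w)"
    then have lin: "linear f" and le: "f w \<le> lower w" for w by blast+
    have "0 \<le> f w" if "0 \<le> w" for w
      using le[of "- w"] lower_le[of "- w" 0] that by (simp add: R_def linear_neg[OF lin])
    moreover have "f u = 1"
      using le[of u] lower_le[of u 1] le[of "- u"] lower_le[of "- u" "- 1"]
      by (simp add: R_def linear_neg[OF lin])
    ultimately show "f \<in> states u"
      using lin by (auto simp: states_iff[OF unit])
  qed
  obtain f where f: "linear f" "\<And>w. f w \<le> lower w" "f (- x) = lower (- x)"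
    "\<And>g h t. linear g \<Longrightarrow> linear h \<Longrightarrow> (\<And>w. g w \<le> lower w) \<Longrightarrow> (\<And>w. h w \<le> lower w) \<Longrightarrow>
       0 < t \<Longrightarrow> t < 1 \<Longrightarrow> (\<And>w. f w = (1 - t) * g w + t * h w) \<Longrightarrow> g = f \<and> h = f"
    by (rule Hahn_Banach_extreme[OF sublinear_lower, of "- x"]) blast
  have "f \<in> pure_states u"
    unfolding pure_states_def extreme_point_of_def
  proof (intro CollectI conjI ballI notI)
    show "f \<in> states u" using f by (simp add: state_iff)
    fix g h assume gh: "g \<in> states u" "h \<in> states u" "f \<in> open_segment g h"
    then obtain t where t: "0 < t" "t < 1" "g \<noteq> h" "f = (1 - t) *\<^sub>R g + t *\<^sub>R h"
      by (auto simp: in_segment)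
    have "g = f \<and> h = f"
    proof (rule f(4)[OF _ _ _ _ t(1,2)])
      show "linear g" "linear h" "\<And>w. g w \<le> lower w" "\<And>w. h w \<le> lower w"
        using gh by (auto simp: state_iff)
      show "f w = (1 - t) * g w + t * h w" for w
        by (subst t(4)) simp
    qed
    with t(3) show False by simp
  qed
  with pos have "0 \<le> f x" by blast
  then have low: "lower (- x) \<le> 0"
    using f(3) by (simp add: linear_neg[OF f(1)])
  \<comment> \<open>The infimum may not be attained, so \<open>inverse (real n)\<close> serves as
    slack above 0 before multiplying by \<open>n\<close>.\<close>
  have "real n *\<^sub>R (- x) \<le> u" for n
  proof (cases "n = 0")
    case True
    with u show ?thesis by simp
  next
    case False
    then have "lower (- x) < inverse (real n)"
      using low by (simp add: le_less_trans)
    then obtain t where t: "t < inverse (real n)" "- x \<le> t *\<^sub>R u"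
      using lower_less by (auto simp: R_def)
    have "- x \<le> inverse (real n) *\<^sub>R u"
      using t scaleR_right_mono[of t "inverse (real n)" u] u by (meson less_imp_le order_trans)
    then have "real n *\<^sub>R (- x) \<le> real n *\<^sub>R (inverse (real n) *\<^sub>R u)"
      by (intro scaleR_left_mono) auto
    with False show ?thesis by simp
  qed
  then have "- x \<le> 0" using archimedean by blast
  then show ?thesis by simp
qed

text \<open>Splitting \<phi> into the positive functionals \<psi> and \<open>\<phi> - \<psi>\<close>
  and normalizing both writes \<phi> as a convex combination of two states with weights
  \<open>\<psi> u\<close> and \<open>1 - \<psi> u\<close>. Extremality makes these states
  equal.\<close>

lemma pure_state_dominates_multiples:
  fixes u x :: "'a::ordered_real_vector"
  assumes unit: "order_unit u" and pure: "\<phi> \<in> pure_states u"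
    and \<psi>: "linear \<psi>" "\<And>x. 0 \<le> x \<Longrightarrow> 0 \<le> \<psi> x" "\<And>x. 0 \<le> x \<Longrightarrow> \<psi> x \<le> \<phi> x"
  shows "\<psi> x = \<psi> u * \<phi> x"
proof -
  have u: "0 \<le> u" using unit by (simp add: order_unit_def)
  have lin: "linear \<phi>" and one: "\<phi> u = 1"
    using subsetD[OF pure_states_subset pure] by (auto simp: states_iff[OF unit])
  \<comment> \<open>A positive functional vanishing at \<open>u\<close> is zero. This settles the
    weights 0 and 1, where normalization would divide by 0.\<close>
  have vanish: "f x = 0" if f: "linear f" "\<And>x. 0 \<le> x \<Longrightarrow> 0 \<le> f x" "f u = 0" for f :: "'a \<Rightarrow> real"
  proof -
    obtain \<alpha> where "- (\<alpha> *\<^sub>R u) \<le> x" "x \<le> \<alpha> *\<^sub>R u"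
      using unit by (auto simp: order_unit_def)
    with linear_mono[of f, OF f(1,2)] have "f (- (\<alpha> *\<^sub>R u)) \<le> f x" "f x \<le> f (\<alpha> *\<^sub>R u)"
      by blast+
    then show ?thesis
      using f(3) by (simp add: linear_neg[OF f(1)] linear_scale[OF f(1)])
  qed
  have lin': "linear (\<lambda>x. \<phi> x - \<psi> x)"
    by (rule linear_compose_sub[OF lin \<psi>(1)])
  define t where "t = \<psi> u"
  have "0 \<le> t" "t \<le> 1" using \<psi>(2,3)[OF u] one by (auto simp: t_def)
  then consider "t = 0" | "t = 1" | "0 < t" "t < 1" by linarith
  then show ?thesis
  proof cases
    case 1
    then show ?thesis using vanish[OF \<psi>(1,2)] by (simp add: t_def)
  next
    case 2
    then show ?thesis using vanish[OF lin'] \<psi>(3) one by (simp add: t_def)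
  next
    case 3
    define g where "g = (\<lambda>x. (1 / (1 - t)) *\<^sub>R (\<phi> x - \<psi> x))"
    define h where "h = (\<lambda>x. (1 / t) *\<^sub>R \<psi> x)"
    have "linear g" "linear h"
      unfolding g_def h_def by (intro linear_compose_scale_right lin' \<psi>(1))+
    then have "g \<in> states u" "h \<in> states u"
      using 3 \<psi>(2,3) one by (auto simp: states_iff[OF unit] g_def h_def t_def)
    moreover have "\<phi> = (1 - t) *\<^sub>R g + t *\<^sub>R h"
      using 3 by (simp add: fun_eq_iff g_def h_def)
    ultimately have "g = h"
      using pure 3 unfolding pure_states_def extreme_point_of_def by (auto simp: in_segment)
    then have "(1 / (1 - t)) * (\<phi> x - \<psi> x) = (1 / t) * \<psi> x"
      by (simp add: g_def h_def fun_eq_iff)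
    then have "\<psi> x = t * \<phi> x"
      using 3 by (simp add: field_simps)
    then show ?thesis by (simp add: t_def)
  qed
qed

text \<open>Shifted by \<open>b\<close>, the common upper bounds become those of
  \<open>a - b\<close> and 0. A Hahn-Banach functional attaining the infimum of \<phi> over them
  lies between 0 and \<phi> on the cone, so it is \<open>t\<close> times \<phi> with
  \<open>t\<close> in [0,1]; the infimum is therefore at most
  \<open>max (\<phi> a - \<phi> b) 0\<close>.\<close>

lemma pure_state_upper_bound:
  fixes u :: "'a::ordered_real_vector"
  assumes unit: "order_unit u" and pure: "\<phi> \<in> pure_states u" and less: "max (\<phi> a) (\<phi> b) < c"
  obtains z where "a \<le> z" "b \<le> z" "\<phi> z < c"
proof -
  have lin: "linear \<phi>" and pos: "\<And>x. 0 \<le> x \<Longrightarrow> 0 \<le> \<phi> x" and one: "\<phi> u = 1"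
    using subsetD[OF pure_states_subset pure] by (auto simp: states_iff[OF unit])
  have u: "0 \<le> u" using unit by (simp add: order_unit_def)
  define R where "R w t \<longleftrightarrow> (\<exists>z\<ge>0. w \<le> z \<and> \<phi> z \<le> t)" for w t
  interpret epigraph_cone R
  proof
    fix w t v s assume "R w t" "R v s"
    then obtain z y where "0 \<le> z" "w \<le> z" "\<phi> z \<le> t" "0 \<le> y" "v \<le> y" "\<phi> y \<le> s"
      by (auto simp: R_def)
    then show "R (w + v) (t + s)"
      unfolding R_def by (intro exI[of _ "z + y"]) (simp add: add_mono linear_add[OF lin])
  next
    fix c w t assume c: "(0::real) < c" and "R w t"
    then obtain z where "0 \<le> z" "w \<le> z" "\<phi> z \<le> t" by (auto simp: R_def)
    with c show "R (c *\<^sub>R w) (c * t)"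
      unfolding R_def
      by (intro exI[of _ "c *\<^sub>R z"])
        (auto simp: linear_scale[OF lin] scaleR_nonneg_nonneg intro: scaleR_left_mono)
  next
    show "R 0 0" unfolding R_def by (intro exI[of _ 0]) (simp add: linear_0[OF lin])
  next
    fix t assume "R 0 t"
    then show "0 \<le> t" using pos by (force simp: R_def)
  next
    fix w
    obtain \<alpha> where "0 \<le> \<alpha>" "w \<le> \<alpha> *\<^sub>R u" using unit by (auto simp: order_unit_def)
    then show "\<exists>t. R w t"
      unfolding R_def using u by (metis order_refl scaleR_nonneg_nonneg)
  qed
  obtain \<psi> where \<psi>: "linear \<psi>" "\<And>w. \<psi> w \<le> lower w" "\<psi> (a - b) = lower (a - b)"
    by (rule Hahn_Banach_extreme[OF sublinear_lower, of "a - b"]) blast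
  \<comment> \<open>For \<open>0 \<le> w\<close>, the witness \<open>z = 0\<close> at
    \<open>- w\<close> gives positivity, and the witness \<open>z = w\<close> at \<open>w\<close>
    gives domination by \<phi>.\<close>
  have nonneg: "0 \<le> \<psi> w" if "0 \<le> w" for w
  proof -
    have "R (- w) 0"
      unfolding R_def using that by (intro exI[of _ 0]) (simp add: linear_0[OF lin])
    then show ?thesis
      using \<psi>(2)[of "- w"] lower_le by (fastforce simp: linear_neg[OF \<psi>(1)])
  qed
  have dom: "\<psi> w \<le> \<phi> w" if "0 \<le> w" for w
  proof -
    have "R w (\<phi> w)" unfolding R_def using that by blast
    then show ?thesis using \<psi>(2)[of w] lower_le order_trans by blast
  qed
  define t where "t = \<psi> u"
  have "0 \<le> t" "t \<le> 1" using nonneg[OF u] dom[OF u] one by (auto simp: t_def)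
  have "lower (a - b) = t * (\<phi> a - \<phi> b)"
    using pure_state_dominates_multiples[OF unit pure \<psi>(1) nonneg dom, of "a - b"] \<psi>(3)
    by (simp add: t_def linear_diff[OF lin])
  also have "\<dots> \<le> max (\<phi> a - \<phi> b) 0"
  proof (cases "\<phi> a - \<phi> b \<ge> 0")
    case True
    then show ?thesis using \<open>t \<le> 1\<close> mult_left_le_one_le[of "\<phi> a - \<phi> b" t] \<open>0 \<le> t\<close> by simp
  next
    case False
    then show ?thesis using \<open>0 \<le> t\<close> mult_nonneg_nonpos[of t "\<phi> a - \<phi> b"] by simp
  qed
  also have "\<dots> < c - \<phi> b" using less by auto
  finally obtain s where "s < c - \<phi> b" "R (a - b) s" using lower_less by blast
  then obtain z where "0 \<le> z" "a - b \<le> z" "\<phi> z < c - \<phi> b" by (auto simp: R_def)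
  then show thesis
    by (intro that[of "z + b"]) (auto simp: linear_add[OF lin] algebra_simps)
qed

section \<open>Disjointness tested on functionals\<close>

text \<open>At a single functional this is the fact that real numbers satisfy
  \<open>\<bar>s + t\<bar> = \<bar>s - t\<bar>\<close> iff one of them is 0, the absolute values
  being maxima over the two pairs.\<close>

lemma disjoint_iff_pure_states:
  fixes u x y :: "'a::ordered_real_vector"
  assumes archimedean: "\<forall>x y :: 'a. (\<forall>n::nat. real n *\<^sub>R x \<le> y) \<longrightarrow> x \<le> 0"
    and unit: "order_unit u"
  shows "disjoint_elements x y \<longleftrightarrow> (\<forall>\<phi>\<in>pure_states u. \<phi> x = 0 \<or> \<phi> y = 0)"
proof
  assume disj: "disjoint_elements x y"
  show "\<forall>\<phi>\<in>pure_states u. \<phi> x = 0 \<or> \<phi> y = 0"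
  proof
    fix \<phi> assume \<phi>: "\<phi> \<in> pure_states u"
    note lin = pure_states_linear[OF \<phi>]
    \<comment> \<open>Otherwise some upper bound \<open>z\<close> of \<open>a\<close> and
      \<open>b\<close> has \<open>\<phi> z\<close> below the left-hand maximum, although
      \<open>z\<close> also bounds \<open>c\<close> and \<open>d\<close>.\<close>
    have ub: "max (\<phi> c) (\<phi> d) \<le> max (\<phi> a) (\<phi> b)"
      if "upper_bounds {a, b} \<subseteq> upper_bounds {c, d}" for a b c d
    proof (rule ccontr)
      assume "\<not> ?thesis"
      then obtain z where z: "a \<le> z" "b \<le> z" "\<phi> z < max (\<phi> c) (\<phi> d)"
        by (rule pure_state_upper_bound[OF unit \<phi>, OF not_le_imp_less])
      with that have "c \<le> z" "d \<le> z" by (auto simp: upper_bounds_def)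
      then have "max (\<phi> c) (\<phi> d) \<le> \<phi> z"
        by (simp add: pure_states_mono[OF \<phi>])
      with z(3) show False by simp
    qed
    have "max (\<phi> (x - y)) (\<phi> (- x + y)) = max (\<phi> (x + y)) (\<phi> (- x - y))"
      using disj unfolding disjoint_elements_def by (intro antisym ub) auto
    then show "\<phi> x = 0 \<or> \<phi> y = 0"
      by (auto simp: linear_add[OF lin] linear_diff[OF lin] linear_neg[OF lin] max_def split: if_splits)
  qed
next
  assume zero: "\<forall>\<phi>\<in>pure_states u. \<phi> x = 0 \<or> \<phi> y = 0"
  have le_iff: "a \<le> z \<longleftrightarrow> (\<forall>\<phi>\<in>pure_states u. \<phi> a \<le> \<phi> z)" for a z
  proof
    assume "\<forall>\<phi>\<in>pure_states u. \<phi> a \<le> \<phi> z"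
    then have "0 \<le> z - a"
      by (intro nonneg_if_pure_states_nonneg[OF archimedean unit])
        (auto simp: linear_diff[OF pure_states_linear])
    then show "a \<le> z" by simp
  qed (use pure_states_mono in blast)
  \<comment> \<open>If \<phi> vanishes at \<open>x\<close> or \<open>y\<close>, the two pairs of
    values of \<phi> coincide up to order.\<close>
  have "(\<phi> (x + y) \<le> \<phi> z \<and> \<phi> (- x - y) \<le> \<phi> z) \<longleftrightarrow> (\<phi> (x - y) \<le> \<phi> z \<and> \<phi> (- x + y) \<le> \<phi> z)"
    if "\<phi> \<in> pure_states u" for \<phi> z
    using zero that pure_states_linear[OF that]
    by (auto simp: linear_add linear_diff linear_neg)
  then show "disjoint_elements x y"
    unfolding disjoint_elements_def upper_bounds_def by (auto simp: le_iff)
qed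

section \<open>Weak* closures\<close>

lemma closedin_eval: "closedin (powertop_real UNIV) {\<phi>. \<phi> x = (c::real)}"
proof -
  have "continuous_map (powertop_real UNIV) euclideanreal (\<lambda>\<phi>. \<phi> x)"
    by (rule continuous_map_product_projection) simp
  from closedin_continuous_map_preimage[OF this, of "{c}"] show ?thesis
    by simp
qed

lemma weak_star_closure_subset:
  assumes "closedin (powertop_real UNIV) C" "S \<subseteq> C"
  shows "weak_star u closure_of S \<subseteq> C"
proof -
  have "weak_star u closure_of S \<subseteq> powertop_real UNIV closure_of S"
    unfolding weak_star_def by (rule closure_of_subtopology_subset)
  also have "\<dots> \<subseteq> C" by (rule closure_of_minimal[OF assms(2,1)])
  finally show ?thesis .
qed

lemma topspace_weak_star: "topspace (weak_star u) = norm_dual u"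
  by (simp add: weak_star_def)

lemma closed_pure_states_norm_dual: "closed_pure_states u \<subseteq> norm_dual u"
  using closure_of_subset_topspace[of "weak_star u" "pure_states u"]
  by (simp add: closed_pure_states_def topspace_weak_star)

lemma pure_states_closed: "pure_states u \<subseteq> closed_pure_states u"
proof -
  have "pure_states u \<subseteq> norm_dual u"
    by (rule subset_trans[OF pure_states_subset]) (auto simp: states_def dual_cone_def)
  then show ?thesis
    unfolding closed_pure_states_def by (intro closure_of_subset) (simp add: topspace_weak_star)
qed

lemma closed_pure_states_unit:
  assumes "\<phi> \<in> closed_pure_states u"
  shows "\<phi> u = 1"
proof -
  have "pure_states u \<subseteq> {\<phi>. \<phi> u = 1}"
    by (rule subset_trans[OF pure_states_subset]) (auto simp: states_def)
  from weak_star_closure_subset[OF closedin_eval this] show ?thesis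
    using assms by (auto simp: closed_pure_states_def)
qed

text \<open>For fixed \<open>x\<close> and \<open>y\<close> the condition on \<phi> defines a union
  of two closed hyperplanes, so it passes to limits.\<close>

lemma disjoint_iff_closed_pure_states:
  fixes u x y :: "'a::ordered_real_vector"
  assumes "\<forall>x y :: 'a. (\<forall>n::nat. real n *\<^sub>R x \<le> y) \<longrightarrow> x \<le> 0" and "order_unit u"
  shows "disjoint_elements x y \<longleftrightarrow> (\<forall>\<phi>\<in>closed_pure_states u. \<phi> x = 0 \<or> \<phi> y = 0)"
proof
  assume "disjoint_elements x y"
  then have "pure_states u \<subseteq> {\<phi>. \<phi> x = 0} \<union> {\<phi>. \<phi> y = 0}"
    using disjoint_iff_pure_states[OF assms] by blast
  then have "closed_pure_states u \<subseteq> {\<phi>. \<phi> x = 0} \<union> {\<phi>. \<phi> y = 0}"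
    unfolding closed_pure_states_def
    by (intro weak_star_closure_subset closedin_Un closedin_eval)
  then show "\<forall>\<phi>\<in>closed_pure_states u. \<phi> x = 0 \<or> \<phi> y = 0" by blast
next
  assume "\<forall>\<phi>\<in>closed_pure_states u. \<phi> x = 0 \<or> \<phi> y = 0"
  then show "disjoint_elements x y"
    using pure_states_closed by (subst disjoint_iff_pure_states[OF assms]) blast
qed

section \<open>Saturated hulls as annihilators of zero sets\<close>

lemma subspace_norm_dual: "subspace (norm_dual u)"
proof (rule subspaceI)
  show "0 \<in> norm_dual u"
    by (auto simp: norm_dual_def zero_fun_def intro: linear_zero exI[of _ 0])
next
  fix f g assume "f \<in> norm_dual u" "g \<in> norm_dual u"
  then obtain C D where fg: "linear f" "linear g" and
    C: "\<And>x. \<bar>f x\<bar> \<le> C * unit_norm u x" and D: "\<And>x. \<bar>g x\<bar> \<le> D * unit_norm u x"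
    by (auto simp: norm_dual_def)
  have "\<bar>f x + g x\<bar> \<le> (C + D) * unit_norm u x" for x
    using C[of x] D[of x] by (simp add: distrib_right)
  with fg show "f + g \<in> norm_dual u"
    by (auto simp: norm_dual_def plus_fun_def intro: linear_compose_add)
next
  fix c :: real and f assume "f \<in> norm_dual u"
  then obtain C where f: "linear f" and C: "\<And>x. \<bar>f x\<bar> \<le> C * unit_norm u x"
    by (auto simp: norm_dual_def)
  have "\<bar>c * f x\<bar> \<le> (\<bar>c\<bar> * C) * unit_norm u x" for x
    using mult_left_mono[OF C[of x], of "\<bar>c\<bar>"] by (simp add: abs_mult mult.assoc)
  with f show "c *\<^sub>R f \<in> norm_dual u"
    by (auto simp: norm_dual_def scaleR_fun_def intro: linear_compose_scale_right[of f c, simplified])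
qed

text \<open>Induction on \<open>F\<close>: a \<sigma> in \<open>S\<close> with
  \<open>\<sigma> x = 1\<close> corrects the value at the new point, and the remainder
  \<open>\<phi> - \<phi> x *\<^sub>R \<sigma>\<close> is interpolated on the old points within the
  subspace of \<open>S\<close> vanishing at \<open>x\<close>.\<close>

lemma finite_interpolation:
  fixes S :: "('a::real_vector \<Rightarrow> real) set"
  assumes "finite F" "subspace S" "\<And>\<psi>. \<psi> \<in> S \<Longrightarrow> linear \<psi>" "linear \<phi>"
    "\<And>x. x \<in> zero_set S \<Longrightarrow> \<phi> x = 0"
  obtains \<psi> where "\<psi> \<in> S" "\<And>x. x \<in> F \<Longrightarrow> \<psi> x = \<phi> x"
proof -
  have "\<exists>\<psi>\<in>S. \<forall>x\<in>F. \<psi> x = \<phi> x"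
    using assms
  proof (induction F arbitrary: S \<phi> rule: finite_induct)
    case empty
    then show ?case using subspace_0 by blast
  next
    case (insert x F)
    note S = insert.prems(1) and linS = insert.prems(2) and lin = insert.prems(3)
      and zero = insert.prems(4)
    show ?case
    proof (cases "\<forall>\<psi>\<in>S. \<psi> x = 0")
      case True
      then have "\<phi> x = 0" using zero by (auto simp: zero_set_def)
      with True insert.IH[OF insert.prems] show ?thesis by auto
    next
      case False
      then obtain \<tau> where \<tau>: "\<tau> \<in> S" "\<tau> x \<noteq> 0" by blast
      define \<sigma> where "\<sigma> = (1 / \<tau> x) *\<^sub>R \<tau>"
      have \<sigma>: "\<sigma> \<in> S" "\<sigma> x = 1"
        using \<tau> S by (auto simp: \<sigma>_def subspace_scale)
      define S' where "S' = {\<psi> \<in> S. \<psi> x = 0}"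
      define \<phi>' where "\<phi>' = (\<lambda>z. \<phi> z - \<phi> x *\<^sub>R \<sigma> z)"
      have "\<exists>\<psi>\<in>S'. \<forall>z\<in>F. \<psi> z = \<phi>' z"
      proof (rule insert.IH)
        show "subspace S'"
          using S by (auto simp: S'_def subspace_def)
        show "linear \<psi>" if "\<psi> \<in> S'" for \<psi>
          using that linS by (auto simp: S'_def)
        show "linear \<phi>'"
          unfolding \<phi>'_def
          by (intro linear_compose_sub lin linear_compose_scale_right linS \<sigma>)
        fix z assume z: "z \<in> zero_set S'"
        \<comment> \<open>Each \<psi> in \<open>S\<close> differs from an element of
          \<open>S'\<close> by \<open>\<psi> x *\<^sub>R \<sigma>\<close>; since \<open>S'\<close>
          vanishes at \<open>z\<close>, this gives
          \<open>\<psi> z = \<psi> x * \<sigma> z\<close>.\<close>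
        have "z - \<sigma> z *\<^sub>R x \<in> zero_set S"
          unfolding zero_set_def
        proof (intro CollectI ballI)
          fix \<psi> assume \<psi>: "\<psi> \<in> S"
          have "\<psi> - \<psi> x *\<^sub>R \<sigma> \<in> S'"
            using \<psi> \<sigma> S by (auto simp: S'_def intro: subspace_diff subspace_scale)
          then have "(\<psi> - \<psi> x *\<^sub>R \<sigma>) z = 0"
            using z by (auto simp: zero_set_def)
          then show "\<psi> (z - \<sigma> z *\<^sub>R x) = 0"
            using linS[OF \<psi>] by (simp add: linear_diff linear_scale mult.commute)
        qed
        then have "\<phi> (z - \<sigma> z *\<^sub>R x) = 0" by (rule zero)
        then show "\<phi>' z = 0"
          by (simp add: \<phi>'_def linear_diff[OF lin] linear_scale[OF lin] mult.commute)
      qed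
      then obtain \<psi> where \<psi>: "\<psi> \<in> S" "\<psi> x = 0" "\<And>z. z \<in> F \<Longrightarrow> \<psi> z = \<phi> z - \<phi> x * \<sigma> z"
        by (auto simp: S'_def \<phi>'_def)
      have "\<psi> + \<phi> x *\<^sub>R \<sigma> \<in> S"
        using \<psi> \<sigma> S by (intro subspace_add subspace_scale)
      with \<psi> \<sigma> show ?thesis
        by (intro bexI[of _ "\<psi> + \<phi> x *\<^sub>R \<sigma>"]) auto
    qed
  qed
  then show thesis using that by blast
qed

text \<open>Evaluating a linear combination of elements of \<open>N\<close> at \<open>u\<close>
  returns the sum of its coefficients.\<close>

lemma affine_hull_if_span:
  fixes N :: "('a \<Rightarrow> real) set"
  assumes "\<psi> \<in> span N" "\<psi> u = 1" "\<And>\<phi>. \<phi> \<in> N \<Longrightarrow> \<phi> u = 1"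
  shows "\<psi> \<in> affine hull N"
proof -
  obtain T r where T: "finite T" "T \<subseteq> N" "\<psi> = (\<Sum>v\<in>T. r v *\<^sub>R v)"
    using assms(1) by (auto simp: span_explicit)
  have "linear (\<lambda>\<phi>::'a \<Rightarrow> real. \<phi> u)" by (rule linearI) auto
  from linear_sum[OF this, of "\<lambda>v. r v *\<^sub>R v" T] have "1 = (\<Sum>v\<in>T. r v * v u)"
    using T(3) assms(2) by simp
  also have "\<dots> = sum r T"
    using T(2) assms(3) by (intro sum.cong) auto
  finally have "sum r T = 1" by simp
  moreover from this have "T \<noteq> {}" by auto
  ultimately show ?thesis
    unfolding affine_hull_explicit using T by blast
qed

lemma zero_set_span: "zero_set (span N) = zero_set (N :: ('a \<Rightarrow> real) set)"
proof
  show "zero_set (span N) \<subseteq> zero_set N"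
    using span_superset by (fastforce simp: zero_set_def)
  have "subspace {\<phi> :: 'a \<Rightarrow> real. \<phi> x = 0}" for x
    by (simp add: subspace_def)
  then have "span N \<subseteq> {\<phi>. \<phi> x = 0}" if "x \<in> zero_set N" for x
    using that by (intro span_minimal) (auto simp: zero_set_def)
  then show "zero_set N \<subseteq> zero_set (span N)"
    by (auto simp: zero_set_def)
qed

text \<open>A bipolar argument: a basic weak* neighbourhood constrains finitely many evaluations,
  and there an element of \<open>span N\<close> can match \<phi> as soon as \<phi> vanishes on
  \<open>zero_set N\<close>.\<close>

lemma saturated_hull_eq:
  assumes N: "N \<subseteq> closed_pure_states u"
  shows "closed_pure_states u \<inter> weak_star u closure_of (affine hull N) =
    {\<phi> \<in> closed_pure_states u. \<forall>x\<in>zero_set N. \<phi> x = 0}"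
proof (intro equalityI subsetI)
  fix \<phi> assume \<phi>: "\<phi> \<in> closed_pure_states u \<inter> weak_star u closure_of (affine hull N)"
  have "\<phi> x = 0" if "x \<in> zero_set N" for x
  proof -
    have "x \<in> zero_set (span N)" using that by (simp only: zero_set_span)
    then have "span N \<subseteq> {\<phi>. \<phi> x = 0}" unfolding zero_set_def by blast
    with affine_hull_subset_span have "affine hull N \<subseteq> {\<phi>. \<phi> x = 0}" by (rule subset_trans)
    from weak_star_closure_subset[OF closedin_eval this] show ?thesis
      using \<phi> by blast
  qed
  with \<phi> show "\<phi> \<in> {\<phi> \<in> closed_pure_states u. \<forall>x\<in>zero_set N. \<phi> x = 0}" by blast
next
  fix \<phi> assume "\<phi> \<in> {\<phi> \<in> closed_pure_states u. \<forall>x\<in>zero_set N. \<phi> x = 0}"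
  then have \<phi>: "\<phi> \<in> closed_pure_states u" "\<And>x. x \<in> zero_set N \<Longrightarrow> \<phi> x = 0" by auto
  have dual: "\<phi> \<in> norm_dual u" using \<phi>(1) closed_pure_states_norm_dual by blast
  have span: "span N \<subseteq> norm_dual u"
    using N closed_pure_states_norm_dual by (intro span_minimal subspace_norm_dual) blast
  have "\<phi> \<in> weak_star u closure_of (affine hull N)"
    unfolding in_closure_of
  proof (intro conjI allI impI)
    show "\<phi> \<in> topspace (weak_star u)" using dual by (simp add: weak_star_def)
    fix T assume T: "\<phi> \<in> T \<and> openin (weak_star u) T"
    then obtain V where V: "openin (powertop_real UNIV) V" "T = V \<inter> norm_dual u"
      by (auto simp: weak_star_def openin_subtopology)
    with T have "\<phi> \<in> V" by blast
    then obtain W where W: "finite {i. W i \<noteq> UNIV}" "\<phi> \<in> PiE UNIV W" "PiE UNIV W \<subseteq> V"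
      using V(1) unfolding openin_product_topology_alt by auto
    \<comment> \<open>Interpolating at \<open>u\<close> as well forces \<open>\<psi> u = 1\<close>,
      which moves \<psi> from the span into the affine hull.\<close>
    obtain \<psi> where \<psi>: "\<psi> \<in> span N" "\<And>x. x \<in> insert u {i. W i \<noteq> UNIV} \<Longrightarrow> \<psi> x = \<phi> x"
    proof (rule finite_interpolation)
      show "finite (insert u {i. W i \<noteq> UNIV})" using W(1) by simp
      show "subspace (span N)" by (rule subspace_span)
      show "linear \<psi>" if "\<psi> \<in> span N" for \<psi>
        using that span by (auto simp: norm_dual_def)
      show "linear \<phi>" using dual by (simp add: norm_dual_def)
      show "\<phi> x = 0" if "x \<in> zero_set (span N)" for x
        using that \<phi>(2) by (simp add: zero_set_span)
    qed blast
    have "\<psi> \<in> affine hull N"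
      using \<psi> N closed_pure_states_unit \<phi>(1) by (intro affine_hull_if_span[where u = u]) auto
    moreover have "\<psi> x \<in> W x" for x
      using \<psi>(2)[of x] W(2) by (cases "W x = UNIV") (auto simp: PiE_iff)
    then have "\<psi> \<in> T"
      using W(3) V(2) \<psi>(1) span by (auto simp: PiE_iff subset_iff)
    ultimately show "\<exists>\<psi>. \<psi> \<in> affine hull N \<and> \<psi> \<in> T" by blast
  qed
  with \<phi>(1) show "\<phi> \<in> closed_pure_states u \<inter> weak_star u closure_of (affine hull N)" by blast
qed

text \<open>The hull is computed from the zero set, and conversely passing to the hull does not
  change the zero set.\<close>

lemma zero_set_eq_iff_saturated_hull_eq:
  assumes "M \<subseteq> closed_pure_states u" "N \<subseteq> closed_pure_states u"
  shows "zero_set M = zero_set N \<longleftrightarrow>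
    closed_pure_states u \<inter> weak_star u closure_of (affine hull M) =
    closed_pure_states u \<inter> weak_star u closure_of (affine hull N)"
proof -
  have "zero_set {\<phi> \<in> closed_pure_states u. \<forall>x\<in>zero_set S. \<phi> x = 0} = zero_set S"
    if "S \<subseteq> closed_pure_states u" for S
    using that unfolding zero_set_def by blast
  note hull = this[OF assms(1)] this[OF assms(2)]
  show ?thesis
    unfolding saturated_hull_eq[OF assms(1)] saturated_hull_eq[OF assms(2)]
  proof
    assume "{\<phi> \<in> closed_pure_states u. \<forall>x\<in>zero_set M. \<phi> x = 0} =
      {\<phi> \<in> closed_pure_states u. \<forall>x\<in>zero_set N. \<phi> x = 0}"
    from arg_cong[OF this, of zero_set] show "zero_set M = zero_set N"
      unfolding hull .
  qed simp
qed

text \<open>An element is disjoint from \<open>zero_set M\<close> iff it vanishes at every \<phi>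
  that is nonzero somewhere on \<open>zero_set M\<close>. Saturation says that these \<phi> are
  exactly the ones outside \<open>M\<close>.\<close>

lemma disjoint_complement_zero_set:
  fixes u :: "'a::ordered_real_vector"
  assumes archimedean: "\<forall>x y :: 'a. (\<forall>n::nat. real n *\<^sub>R x \<le> y) \<longrightarrow> x \<le> 0"
    and unit: "order_unit u"
    and M: "M \<subseteq> closed_pure_states u" "saturated u M"
  shows "disjoint_complement (zero_set M) = zero_set (closed_pure_states u - M)"
proof -
  have "M = {\<phi> \<in> closed_pure_states u. \<forall>x\<in>zero_set M. \<phi> x = 0}"
    using M(2) unfolding saturated_def saturated_hull_eq[OF M(1)] .
  then have "\<exists>x\<in>zero_set M. \<phi> x \<noteq> 0" if "\<phi> \<in> closed_pure_states u - M" for \<phi>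
    using that by blast
  then show ?thesis
    unfolding disjoint_complement_def disjoint_iff_closed_pure_states[OF archimedean unit]
    unfolding zero_set_def by blast
qed

theorem proposition15:
  fixes u :: "'a::ordered_real_vector"
    and M\<^sub>1 M\<^sub>2 :: "('a \<Rightarrow> real) set"
    and B\<^sub>1 B\<^sub>2 :: "'a set"
  assumes archimedean: "\<And>x y :: 'a. (\<And>n::nat. real n *\<^sub>R x \<le> y) \<Longrightarrow> x \<le> 0"
    and unit: "order_unit u"
    and M\<^sub>1: "M\<^sub>1 \<subseteq> closed_pure_states u" "saturated u M\<^sub>1"
    and M\<^sub>2: "M\<^sub>2 \<subseteq> closed_pure_states u" "saturated u M\<^sub>2"
    and B\<^sub>1: "B\<^sub>1 = zero_set M\<^sub>1"
    and B\<^sub>2: "B\<^sub>2 = zero_set M\<^sub>2"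
  shows "bisaturated_pair u M\<^sub>1 M\<^sub>2 \<longleftrightarrow>
           B\<^sub>1 = disjoint_complement B\<^sub>2 \<and> B\<^sub>2 = disjoint_complement B\<^sub>1"
proof -
  have arch: "\<forall>x y :: 'a. (\<forall>n::nat. real n *\<^sub>R x \<le> y) \<longrightarrow> x \<le> 0"
  proof (intro allI impI)
    fix x y :: 'a
    assume "\<forall>n::nat. real n *\<^sub>R x \<le> y"
    then have "real n *\<^sub>R x \<le> y" for n by blast
    then show "x \<le> 0" by (rule archimedean)
  qed
  \<comment> \<open>The two bisaturation equations translate separately. Since \<open>M\<close> is
    its own hull, the equation compares two hulls, hence two zero sets, and the zero set of the
    complement of \<open>N\<close> is a disjoint complement.\<close>
  have key: "M = closed_pure_states u \<inter>
      weak_star u closure_of (affine hull (closed_pure_states u - N)) \<longleftrightarrow>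
    zero_set M = disjoint_complement (zero_set N)"
    if M: "M \<subseteq> closed_pure_states u" "saturated u M"
      and N: "N \<subseteq> closed_pure_states u" "saturated u N" for M N
  proof -
    have "closed_pure_states u \<inter> weak_star u closure_of (affine hull M) = M"
      using M(2) unfolding saturated_def by (rule sym)
    then show ?thesis
      by (simp only: disjoint_complement_zero_set[OF arch unit N]
        zero_set_eq_iff_saturated_hull_eq[OF M(1) Diff_subset])
  qed
  show ?thesis
    unfolding bisaturated_pair_def B\<^sub>1 B\<^sub>2 key[OF M\<^sub>1 M\<^sub>2, symmetric] key[OF M\<^sub>2 M\<^sub>1, symmetric]
    by (rule refl)
qed

end
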